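(* The nilpotent non-Lie Malcev algebra $\mathbb{M}$ is special: there exists an alternative algebra $A$ over $\mathbb{F}$ such that $\mathbb{M}$ is isomorphic to a subalgebra of $A^-$.
   Context: Let $\mathbb{F}$ be a field of characteristic $\ne 2,3$. $\mathbb{M}$ is the 5-dimensional nilpotent Malcev algebra over $\mathbb{F}$ with basis $a,b,c,d,e$ and anticommutative product determined by $[a,b]=c$, $[c,d]=e$ (so $[b,a]=-c$, $[d,c]=-e$), all other products of basis elements being $0$. A (nonassociative) algebra $A$ is alternative if $(x,x,y)=0=(y,x,x)$ for all $x,y\in A$, where $(x,y,z)=(xy)z-x(yz)$. $A^-$ denotes the same vector space with the product $[x,y]=xy-yx$. *)

theory Defs
  imports "HOL-Analysis.Analysis" "HOL-Library.Poly_Mapping"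
begin

locale nonassoc_algebra = vector_space smul
  for smul :: "'f::field \<Rightarrow> 'v::ab_group_add \<Rightarrow> 'v" +
  fixes mul :: "'v \<Rightarrow> 'v \<Rightarrow> 'v"
  assumes linear_mul_left: "Vector_Spaces.linear smul smul (\<lambda>x. mul x y)"
    and linear_mul_right: "Vector_Spaces.linear smul smul (\<lambda>y. mul x y)"

definition associator :: "('v::ab_group_add \<Rightarrow> 'v \<Rightarrow> 'v) \<Rightarrow> 'v \<Rightarrow> 'v \<Rightarrow> 'v \<Rightarrow> 'v" where
  "associator mul x y z = mul (mul x y) z - mul x (mul y z)"

locale alternative_algebra = nonassoc_algebra +
  assumes left_alternative: "associator mul x x y = 0"
    and right_alternative: "associator mul y x x = 0"

text \<open>The product of \<open>A\<^sup>-\<close>; its underlying vector space is that of \<open>A\<close>.\<close>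

definition commutator :: "('v::ab_group_add \<Rightarrow> 'v \<Rightarrow> 'v) \<Rightarrow> 'v \<Rightarrow> 'v \<Rightarrow> 'v" where
  "commutator mul x y = mul x y - mul y x"

definition jacobian :: "('v::ab_group_add \<Rightarrow> 'v \<Rightarrow> 'v) \<Rightarrow> 'v \<Rightarrow> 'v \<Rightarrow> 'v \<Rightarrow> 'v" where
  "jacobian mul x y z = mul (mul x y) z + mul (mul y z) x + mul (mul z x) y"

locale malcev_algebra = nonassoc_algebra +
  assumes malcev_square_zero: "mul x x = 0"
    and malcev_identity: "jacobian mul x y (mul x z) = mul (jacobian mul x y z) x"

locale lie_algebra = nonassoc_algebra +
  assumes lie_square_zero: "mul x x = 0"
    and jacobi_identity: "jacobian mul x y z = 0"

text \<open>\<open>is_product mul n x\<close>: \<open>x\<close> is a product of \<open>n\<close> elements under some bracketing.\<close>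

inductive is_product :: "('v \<Rightarrow> 'v \<Rightarrow> 'v) \<Rightarrow> nat \<Rightarrow> 'v \<Rightarrow> bool"
  for mul :: "'v \<Rightarrow> 'v \<Rightarrow> 'v" where
  "is_product mul 1 x"
| "is_product mul m x \<Longrightarrow> is_product mul n y \<Longrightarrow> is_product mul (m + n) (mul x y)"

text \<open>There are no products of length \<open>0\<close>, so \<open>n \<ge> 1\<close> is essential here.\<close>

locale nilpotent_algebra = nonassoc_algebra +
  assumes nilpotent: "\<exists>n\<ge>1. \<forall>x. is_product mul n x \<longrightarrow> x = 0"

definition is_subalgebra ::
  "('f::field \<Rightarrow> 'v::ab_group_add \<Rightarrow> 'v) \<Rightarrow> ('v \<Rightarrow> 'v \<Rightarrow> 'v) \<Rightarrow> 'v set \<Rightarrow> bool" where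
  "is_subalgebra smul mul S \<longleftrightarrow>
     module.subspace smul S \<and> (\<forall>x\<in>S. \<forall>y\<in>S. mul x y \<in> S)"

definition is_algebra_iso ::
  "('f::field \<Rightarrow> 'v::ab_group_add \<Rightarrow> 'v) \<Rightarrow> ('v \<Rightarrow> 'v \<Rightarrow> 'v) \<Rightarrow>
   ('f \<Rightarrow> 'w::ab_group_add \<Rightarrow> 'w) \<Rightarrow> ('w \<Rightarrow> 'w \<Rightarrow> 'w) \<Rightarrow> 'w set \<Rightarrow> ('v \<Rightarrow> 'w) \<Rightarrow> bool" where
  "is_algebra_iso smul mul smul' mul' S \<phi> \<longleftrightarrow>
     Vector_Spaces.linear smul smul' \<phi> \<and> bij_betw \<phi> UNIV S \<and>
     (\<forall>x y. \<phi> (mul x y) = mul' (\<phi> x) (\<phi> y))"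

text \<open>The algebra \<open>M\<close> is \<open>'f ^ mbasis\<close> with the operation \<open>*s\<close>; its basis
  \<open>a, b, c, d, e\<close> consists of the unit vectors at \<open>Ba, Bb, Bc, Bd, Be\<close>.\<close>

datatype mbasis = Ba | Bb | Bc | Bd | Be

instance mbasis :: finite
proof
  have "(UNIV :: mbasis set) = {Ba, Bb, Bc, Bd, Be}"
    using mbasis.exhaust by blast
  then show "finite (UNIV :: mbasis set)"
    by (metis finite.emptyI finite.insertI)
qed

fun M_table :: "mbasis \<Rightarrow> mbasis \<Rightarrow> ('f::field) ^ mbasis" where
  "M_table Ba Bb = axis Bc 1"
| "M_table Bb Ba = - axis Bc 1"
| "M_table Bc Bd = axis Be 1"
| "M_table Bd Bc = - axis Be 1"
| "M_table _ _ = 0"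

definition M_mul :: "('f::field) ^ mbasis \<Rightarrow> 'f ^ mbasis \<Rightarrow> 'f ^ mbasis" where
  "M_mul x y = (\<Sum>i\<in>UNIV. \<Sum>j\<in>UNIV. (x $ i * y $ j) *s M_table i j)"

text \<open>Existence of an algebra is asserted over the type \<open>nat \<Rightarrow>\<^sub>0 'f\<close>, a vector space of countably
  infinite dimension, since one cannot quantify over types. For a countable-dimensional \<open>M\<close> this
  is no restriction: if \<open>M\<close> embeds into \<open>A\<^sup>-\<close>, then it embeds into \<open>B\<^sup>-\<close> for the subalgebra \<open>B\<close>
  of \<open>A\<close> generated by the image of a basis of \<open>M\<close>; this \<open>B\<close> has countable dimension, and adding
  a direct summand with zero product makes the dimension countably infinite.\<close>

definition special_countable ::
  "('f::field \<Rightarrow> 'm::ab_group_add \<Rightarrow> 'm) \<Rightarrow> ('m \<Rightarrow> 'm \<Rightarrow> 'm) \<Rightarrow> bool" where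
  "special_countable smulM mulM \<longleftrightarrow>
     (\<exists>(smul :: 'f \<Rightarrow> (nat \<Rightarrow>\<^sub>0 'f) \<Rightarrow> (nat \<Rightarrow>\<^sub>0 'f)) mul.
        alternative_algebra smul mul \<and>
        (\<exists>S \<phi>. is_subalgebra smul (commutator mul) S \<and>
               is_algebra_iso smulM mulM smul (commutator mul) S \<phi>))"

end

theory Submission
  imports Defs
begin

text \<open>If \<open>M\<close> sits in \<open>A\<^sup>-\<close> with \<open>A\<close> alternative, then \<open>e = [[a,b],d]\<close> is the Jacobian of
  \<open>a, b, d\<close>, hence equals \<open>6(a,b,d)\<close>. So look for \<open>A\<close> generated by \<open>a, b, d\<close>, graded by multidegree,
  with all components outside the multilinear ones killed. Then the only associators of homogeneous
  elements that can survive are those of \<open>a, b, d\<close> in some order, and alternativity says just that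
  these are alternating. Imposing \<open>ba = -ab\<close>, \<open>ad = da\<close>, \<open>bd = db\<close> and normalizing in the top degree
  leaves a 7-dimensional algebra with basis \<open>a, b, p = ab, d, s = (a,b,d)/2, q = ad, r = bd\<close>,
  in which \<open>c = 2p\<close> and \<open>e = 12s\<close>.\<close>

section \<open>The Malcev algebra\<close>

lemma UNIV_mbasis: "UNIV = {Ba, Bb, Bc, Bd, Be}"
  using mbasis.exhaust by blast

lemma all_mbasis: "(\<forall>i. P i) \<longleftrightarrow> P Ba \<and> P Bb \<and> P Bc \<and> P Bd \<and> P Be"
  by (metis mbasis.exhaust)

lemma sum_mbasis: "(\<Sum>i\<in>UNIV. f i) = f Ba + f Bb + f Bc + f Bd + f Be"
  by (simp add: UNIV_mbasis add.assoc)

lemma M_mul_nth: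
  "M_mul x y $ i =
    (if i = Bc then x $ Ba * y $ Bb - x $ Bb * y $ Ba
     else if i = Be then x $ Bc * y $ Bd - x $ Bd * y $ Bc else 0)"
  by (cases i) (simp_all add: M_mul_def sum_mbasis axis_def)

lemma nonassoc_algebra_M:
  "nonassoc_algebra ((*s) :: 'f::field \<Rightarrow> 'f ^ mbasis \<Rightarrow> 'f ^ mbasis) M_mul"
  by unfold_locales (simp_all add: vec_eq_iff M_mul_nth algebra_simps)

lemma malcev_algebra_M:
  "malcev_algebra ((*s) :: 'f::field \<Rightarrow> 'f ^ mbasis \<Rightarrow> 'f ^ mbasis) M_mul"
proof -
  interpret nonassoc_algebra "(*s) :: 'f \<Rightarrow> 'f ^ mbasis \<Rightarrow> 'f ^ mbasis" M_mul
    by (rule nonassoc_algebra_M)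
  show ?thesis
    by unfold_locales (simp_all add: vec_eq_iff jacobian_def M_mul_nth algebra_simps)
qed

lemma is_product_pos: "is_product mul n x \<Longrightarrow> n \<ge> 1"
  by (induction rule: is_product.induct) auto

text \<open>Give \<open>Ba\<close>, \<open>Bb\<close>, \<open>Bd\<close> weight 1, \<open>Bc\<close>
  weight 2 and \<open>Be\<close> weight 3. Weights add under \<open>M_mul\<close>, so a product of
  \<open>n\<close> factors has only coordinates of weight at least \<open>n\<close>.\<close>

lemma is_product_M_vanishing:
  assumes "is_product M_mul n x"
  shows "(n \<ge> 2 \<longrightarrow> x $ Ba = 0 \<and> x $ Bb = 0 \<and> x $ Bd = 0) \<and> (n \<ge> 3 \<longrightarrow> x $ Bc = 0) \<and>
    (n \<ge> 4 \<longrightarrow> x $ Be = 0)"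
  using assms
proof (induction rule: is_product.induct)
  case (2 m x n y)
  have "m \<ge> 1" "n \<ge> 1"
    using "2.hyps" by (simp_all only: is_product_pos)
  then consider "m = 1" "n = 1" | "m = 1" "n = 2" | "m = 2" "n = 1"
    | "m \<ge> 2" "n \<ge> 2" | "m = 1" "n \<ge> 3" | "m \<ge> 3" "n = 1"
    by linarith
  then show ?case
    using "2.IH" by cases (simp_all add: M_mul_nth)
qed auto

lemma nilpotent_algebra_M:
  "nilpotent_algebra ((*s) :: 'f::field \<Rightarrow> 'f ^ mbasis \<Rightarrow> 'f ^ mbasis) M_mul"
proof -
  interpret nonassoc_algebra "(*s) :: 'f \<Rightarrow> 'f ^ mbasis \<Rightarrow> 'f ^ mbasis" M_mul
    by (rule nonassoc_algebra_M)
  show ?thesis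
    by unfold_locales
      (auto intro!: exI[of _ 4] simp: vec_eq_iff all_mbasis dest: is_product_M_vanishing)
qed

lemma not_lie_algebra_M:
  "\<not> lie_algebra ((*s) :: 'f::field \<Rightarrow> 'f ^ mbasis \<Rightarrow> 'f ^ mbasis) M_mul"
proof
  assume "lie_algebra ((*s) :: 'f \<Rightarrow> 'f ^ mbasis \<Rightarrow> 'f ^ mbasis) M_mul"
  \<comment> \<open>The summands with \<open>[b,d]\<close> and \<open>[d,a]\<close> vanish, so this
    coordinate is in fact 1.\<close>
  then have "jacobian M_mul (axis Ba 1) (axis Bb 1) (axis Bd 1 :: 'f ^ mbasis) $ Be = 0"
    by (simp add: lie_algebra.jacobi_identity)
  then show False
    by (simp add: jacobian_def M_mul_nth axis_def)
qed

section \<open>The alternative envelope\<close>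

definition pm_smul :: "'f::field \<Rightarrow> (nat \<Rightarrow>\<^sub>0 'f) \<Rightarrow> (nat \<Rightarrow>\<^sub>0 'f)" where
  "pm_smul k x = Poly_Mapping.map ((*) k) x"

lemma lookup_pm_smul: "Poly_Mapping.lookup (pm_smul k x) i = k * Poly_Mapping.lookup x i"
  by (simp add: pm_smul_def map.rep_eq when_def)

text \<open>The basis \<open>a, b, p, d, s, q, r\<close> corresponds to the indices \<open>0, \<dots>, 6\<close>; all other basis
  elements of \<open>nat \<Rightarrow>\<^sub>0 'f\<close> annihilate everything.\<close>

definition env_mul :: "(nat \<Rightarrow>\<^sub>0 'f::field) \<Rightarrow> (nat \<Rightarrow>\<^sub>0 'f) \<Rightarrow> (nat \<Rightarrow>\<^sub>0 'f)" where
  "env_mul x y = (let X = Poly_Mapping.lookup x; Y = Poly_Mapping.lookup y in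
     Poly_Mapping.single 2 (X 0 * Y 1 - X 1 * Y 0)
   + Poly_Mapping.single 4 (3 * (X 2 * Y 3 - X 3 * Y 2)
       + (X 0 * Y 6 + X 6 * Y 0) - (X 1 * Y 5 + X 5 * Y 1))
   + Poly_Mapping.single 5 (X 0 * Y 3 + X 3 * Y 0)
   + Poly_Mapping.single 6 (X 1 * Y 3 + X 3 * Y 1))"

lemma lookup_env_mul:
  "Poly_Mapping.lookup (env_mul x y) i = (let X = Poly_Mapping.lookup x; Y = Poly_Mapping.lookup y in
     if i = 2 then X 0 * Y 1 - X 1 * Y 0
     else if i = 4 then 3 * (X 2 * Y 3 - X 3 * Y 2)
       + (X 0 * Y 6 + X 6 * Y 0) - (X 1 * Y 5 + X 5 * Y 1)
     else if i = 5 then X 0 * Y 3 + X 3 * Y 0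
     else if i = 6 then X 1 * Y 3 + X 3 * Y 1 else 0)"
  by (simp add: env_mul_def Let_def lookup_add lookup_single when_def)

lemma vector_space_pm_smul: "vector_space (pm_smul :: 'f::field \<Rightarrow> _)"
  by unfold_locales
    (simp_all add: poly_mapping_eq_iff fun_eq_iff lookup_pm_smul lookup_add algebra_simps)

lemma nonassoc_algebra_env: "nonassoc_algebra (pm_smul :: 'f::field \<Rightarrow> _) env_mul"
proof -
  interpret vector_space "pm_smul :: 'f \<Rightarrow> _"
    by (rule vector_space_pm_smul)
  show ?thesis
    by unfold_locales
      (simp_all add: poly_mapping_eq_iff fun_eq_iff lookup_pm_smul lookup_add lookup_env_mul
        Let_def algebra_simps)
qed

text \<open>Products of three factors lie on the line of \<open>s\<close>. There the associator is
  twice the determinant of the coordinates 0, 1, 3 of its arguments, hence alternating.\<close>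

lemma alternative_algebra_env: "alternative_algebra (pm_smul :: 'f::field \<Rightarrow> _) env_mul"
proof -
  interpret nonassoc_algebra "pm_smul :: 'f \<Rightarrow> _" env_mul
    by (rule nonassoc_algebra_env)
  show ?thesis
    by unfold_locales
      (simp_all add: poly_mapping_eq_iff fun_eq_iff associator_def lookup_minus lookup_env_mul
        Let_def algebra_simps)
qed

definition env_embed :: "'f::field ^ mbasis \<Rightarrow> (nat \<Rightarrow>\<^sub>0 'f)" where
  "env_embed v = Poly_Mapping.single 0 (v $ Ba) + Poly_Mapping.single 1 (v $ Bb)
     + Poly_Mapping.single 2 (2 * v $ Bc) + Poly_Mapping.single 3 (v $ Bd)
     + Poly_Mapping.single 4 (12 * v $ Be)"

lemma lookup_env_embed:
  "Poly_Mapping.lookup (env_embed v) i =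
    (if i = 0 then v $ Ba else if i = 1 then v $ Bb else if i = 2 then 2 * v $ Bc
     else if i = 3 then v $ Bd else if i = 4 then 12 * v $ Be else 0)"
  by (simp add: env_embed_def lookup_add lookup_single when_def)

lemma linear_env_embed: "Vector_Spaces.linear (*s) pm_smul (env_embed :: 'f::field ^ mbasis \<Rightarrow> _)"
proof -
  interpret vector_space "pm_smul :: 'f \<Rightarrow> _"
    by (rule vector_space_pm_smul)
  show ?thesis
    by unfold_locales
      (simp_all add: poly_mapping_eq_iff fun_eq_iff lookup_pm_smul lookup_add lookup_env_embed
        algebra_simps)
qed

text \<open>Symmetric terms cancel in the commutator and skew ones double: \<open>[a,b] = 2p\<close>
  and \<open>[2p,d] = 12s\<close>.\<close>

lemma env_embed_M_mul: "env_embed (M_mul x y) = commutator env_mul (env_embed x) (env_embed y)"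
  by (simp add: poly_mapping_eq_iff fun_eq_iff commutator_def lookup_minus lookup_env_mul
      lookup_env_embed M_mul_nth Let_def algebra_simps)

text \<open>A field never has characteristic 1, so its characteristic divides a prime only by being
  equal to it.\<close>

lemma prime_neq_CHAR_imp_nonzero:
  assumes "prime p" and "CHAR('f::field) \<noteq> p"
  shows "(of_nat p :: 'f) \<noteq> 0"
  using assms CHAR_not_1' by (auto simp: of_nat_eq_0_iff_char_dvd prime_nat_iff)

text \<open>The hypotheses make the factors 2 and 12 in \<open>env_embed\<close> invertible.\<close>

lemma inj_env_embed:
  assumes "CHAR('f::field) \<noteq> 2" and "CHAR('f) \<noteq> 3"
  shows "inj (env_embed :: 'f ^ mbasis \<Rightarrow> _)"
proof (rule injI)
  fix v w :: "'f ^ mbasis"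
  assume "env_embed v = env_embed w"
  then have eq: "Poly_Mapping.lookup (env_embed v) i = Poly_Mapping.lookup (env_embed w) i" for i
    by simp
  have "(2::'f) \<noteq> 0" "(3::'f) \<noteq> 0"
    using prime_neq_CHAR_imp_nonzero[of 2] prime_neq_CHAR_imp_nonzero[of 3] assms by auto
  moreover have "(12::'f) = 2 * 2 * 3"
    by simp
  ultimately have "(2::'f) \<noteq> 0" "(12::'f) \<noteq> 0"
    by (metis mult_eq_0_iff)+
  then show "v = w"
    using eq[of 0] eq[of 1] eq[of 2] eq[of 3] eq[of 4]
    by (simp add: vec_eq_iff all_mbasis lookup_env_embed)
qed

lemma special_countable_M:
  assumes "CHAR('f::field) \<noteq> 2" and "CHAR('f) \<noteq> 3"
  shows "special_countable ((*s) :: 'f \<Rightarrow> 'f ^ mbasis \<Rightarrow> 'f ^ mbasis) M_mul"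
proof -
  let ?\<phi> = "env_embed :: 'f ^ mbasis \<Rightarrow> _"
  interpret Vector_Spaces.linear "(*s)" pm_smul ?\<phi>
    by (rule linear_env_embed)
  \<comment> \<open>Commutators of images are images of products in \<open>M\<close>.\<close>
  have "is_subalgebra pm_smul (commutator env_mul) (range ?\<phi>)"
    using subspace_image[of UNIV]
    by (auto simp: is_subalgebra_def simp flip: env_embed_M_mul)
  moreover have "is_algebra_iso (*s) M_mul pm_smul (commutator env_mul) (range ?\<phi>) ?\<phi>"
    using inj_env_embed[OF assms]
    by (simp add: is_algebra_iso_def linear_env_embed inj_on_imp_bij_betw env_embed_M_mul)
  ultimately show ?thesis
    unfolding special_countable_def using alternative_algebra_env by blast
qed

theorem corollary5p11:
  assumes "CHAR('f::field) \<noteq> 2" and "CHAR('f) \<noteq> 3"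
  shows "malcev_algebra ((*s) :: 'f \<Rightarrow> 'f ^ mbasis \<Rightarrow> 'f ^ mbasis) M_mul
       \<and> nilpotent_algebra ((*s) :: 'f \<Rightarrow> 'f ^ mbasis \<Rightarrow> 'f ^ mbasis) M_mul
       \<and> \<not> lie_algebra ((*s) :: 'f \<Rightarrow> 'f ^ mbasis \<Rightarrow> 'f ^ mbasis) M_mul
       \<and> special_countable ((*s) :: 'f \<Rightarrow> 'f ^ mbasis \<Rightarrow> 'f ^ mbasis) M_mul"
  using malcev_algebra_M nilpotent_algebra_M not_lie_algebra_M special_countable_M[OF assms]
  by blast

end
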